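(* Let $\varphi$ be an Orlicz function, $I=(0,a)$ with $0<a\le\infty$, and $w$ a decreasing weight function on $I$. The following assertions are equivalent. (i) The dilation operator $D_2$ acts on the class $M_{\varphi,w}$ (that is, $f\in M_{\varphi,w}$ implies $D_2f\in M_{\varphi,w}$). (ii) The dilation operator $D_2$ acts and is bounded on the class $M_{\varphi,w}$ (that is, in addition there is $C>0$ with $\|D_2f\|_M\le C\|f\|_M$ for all $f\in M_{\varphi,w}$). (iii) The class $M_{\varphi,w}$ is linear. (iv) The class $M_{\varphi,w}$ is linear and $\|\cdot\|_M$ is a quasi-norm.
   Context: An Orlicz function is a convex, strictly increasing $\varphi:\mathbb{R}_+\to\mathbb{R}_+$ with $\varphi(0)=0$. "Decreasing" means non-increasing. $L^0$ is the set of Lebesgue measurable $f:I\to\mathbb{R}$ (identified a.e.). For $f\in L^0$, $d_f(s)=|\{t\in I:|f(t)|>s\}|$ and $f^*(t)=\inf\{s\ge0:d_f(s)\le t\}$, $t\in I$ ($\inf\emptyset=\infty$). A weight function is a non-negative decreasing function in $L^0$. $M(f)=\int_I\varphi(f^*/w)w\in[0,\infty]$, with the convention that where $w(t)=0$ the integrand is $0$ if $f^*(t)=0$ and $\infty$ if $f^*(t)\neq0$ (and it is $\infty$ where $f^*(t)=\infty$). $M_{\varphi,w}$ is the class of all $f\in L^0$ with $M(\lambda f)<\infty$ for some $\lambda>0$, and $\|f\|_M=\inf\{\epsilon>0: M(f/\epsilon)\le1\}$. The dilation operator is $D_2f(t)=f(t/2)$, $t\in I$. *)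

theory Defs
  imports "HOL-Analysis.Analysis"
begin

definition orlicz_function :: "(real \<Rightarrow> real) \<Rightarrow> bool" where
  "orlicz_function \<phi> \<longleftrightarrow>
     (\<forall>x\<ge>0. 0 \<le> \<phi> x) \<and> convex_on {0..} \<phi> \<and> strict_mono_on {0..} \<phi> \<and> \<phi> 0 = 0"

text \<open>Elements of L0(I) are represented by total functions whose values off I are irrelevant;
  the identification a.e. is made explicit where it matters (definiteness of a quasi-norm).\<close>

definition L0 :: "real set \<Rightarrow> (real \<Rightarrow> real) set" where
  "L0 I = borel_measurable (lebesgue_on I)"

definition decreasing_weight :: "real set \<Rightarrow> (real \<Rightarrow> real) \<Rightarrow> bool" where
  "decreasing_weight I w \<longleftrightarrow> w \<in> L0 I \<and> (\<forall>t\<in>I. 0 \<le> w t) \<and> antimono_on I w"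

definition distribution_fun :: "real set \<Rightarrow> (real \<Rightarrow> real) \<Rightarrow> real \<Rightarrow> ennreal" where
  "distribution_fun I f s = emeasure lebesgue {t \<in> I. s < \<bar>f t\<bar>}"

text \<open>The infimum is taken in the extended half-line, so it is infinite for the empty set.\<close>

definition rearrangement :: "real set \<Rightarrow> (real \<Rightarrow> real) \<Rightarrow> real \<Rightarrow> ennreal" where
  "rearrangement I f t = Inf (ennreal ` {s. 0 \<le> s \<and> distribution_fun I f s \<le> ennreal t})"

text \<open>The value of \<open>\<phi> (x / v) * v\<close> for \<open>x\<close> in the extended half-line, with the convention
  for \<open>v = 0\<close>.\<close>

definition modular_integrand :: "(real \<Rightarrow> real) \<Rightarrow> ennreal \<Rightarrow> real \<Rightarrow> ennreal" where
  "modular_integrand \<phi> x v =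
     (if x = \<infinity> then \<infinity>
      else if v = 0 then (if x = 0 then 0 else \<infinity>)
      else ennreal (\<phi> (enn2real x / v) * v))"

definition modular ::
  "(real \<Rightarrow> real) \<Rightarrow> (real \<Rightarrow> real) \<Rightarrow> real set \<Rightarrow> (real \<Rightarrow> real) \<Rightarrow> ennreal" where
  "modular \<phi> w I f =
     (\<integral>\<^sup>+ t. modular_integrand \<phi> (rearrangement I f t) (w t) \<partial>lebesgue_on I)"

definition M_class ::
  "(real \<Rightarrow> real) \<Rightarrow> (real \<Rightarrow> real) \<Rightarrow> real set \<Rightarrow> (real \<Rightarrow> real) set" where
  "M_class \<phi> w I = {f \<in> L0 I. \<exists>c>0. modular \<phi> w I (\<lambda>t. c * f t) < \<infinity>}"

definition M_norm ::
  "(real \<Rightarrow> real) \<Rightarrow> (real \<Rightarrow> real) \<Rightarrow> real set \<Rightarrow> (real \<Rightarrow> real) \<Rightarrow> ennreal" where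
  "M_norm \<phi> w I f = Inf (ennreal ` {\<epsilon>. 0 < \<epsilon> \<and> modular \<phi> w I (\<lambda>t. f t / \<epsilon>) \<le> 1})"

definition D2 :: "(real \<Rightarrow> real) \<Rightarrow> real \<Rightarrow> real" where
  "D2 f = (\<lambda>t. f (t / 2))"

definition acts_on :: "((real \<Rightarrow> real) \<Rightarrow> real \<Rightarrow> real) \<Rightarrow> (real \<Rightarrow> real) set \<Rightarrow> bool" where
  "acts_on T X \<longleftrightarrow> (\<forall>f\<in>X. T f \<in> X)"

definition bounded_on ::
  "((real \<Rightarrow> real) \<Rightarrow> real \<Rightarrow> real) \<Rightarrow> (real \<Rightarrow> real) set \<Rightarrow> ((real \<Rightarrow> real) \<Rightarrow> ennreal) \<Rightarrow> bool" where
  "bounded_on T X N \<longleftrightarrow> (\<exists>C::real. 0 < C \<and> (\<forall>f\<in>X. N (T f) \<le> ennreal C * N f))"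

definition linear_class :: "(real \<Rightarrow> real) set \<Rightarrow> bool" where
  "linear_class X \<longleftrightarrow> (\<lambda>t. 0) \<in> X
     \<and> (\<forall>f\<in>X. \<forall>g\<in>X. (\<lambda>t. f t + g t) \<in> X)
     \<and> (\<forall>c. \<forall>f\<in>X. (\<lambda>t. c * f t) \<in> X)"

definition quasi_norm_on ::
  "real set \<Rightarrow> (real \<Rightarrow> real) set \<Rightarrow> ((real \<Rightarrow> real) \<Rightarrow> ennreal) \<Rightarrow> bool" where
  "quasi_norm_on I X N \<longleftrightarrow>
     (\<forall>f\<in>X. N f < \<infinity>)
     \<and> (\<forall>f\<in>X. N f = 0 \<longleftrightarrow> (AE t in lebesgue_on I. f t = 0))
     \<and> (\<forall>c. \<forall>f\<in>X. N (\<lambda>t. c * f t) = ennreal \<bar>c\<bar> * N f)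
     \<and> (\<exists>K::real. 1 \<le> K \<and> (\<forall>f\<in>X. \<forall>g\<in>X. N (\<lambda>t. f t + g t) \<le> ennreal K * (N f + N g)))"

end

theory Submission
  imports Defs
begin

text \<open>
  All assertions are equivalent to stability of the class of right-continuous decreasing \<open>u\<close> with
  finite modular of some positive multiple under \<open>u \<mapsto> u (\<cdot> / 2)\<close>. Stability gives linearity and the
  quasi-triangle inequality through \<open>(f + g)* t \<le> f* (t / 2) + g* (t / 2)\<close>, and boundedness of the
  dilation follows from stability because the modular of a supremum of decreasing functions is
  controlled by the sum of their modulars. Conversely, if the class is linear, then \<open>u (7 t / 8)\<close> is
  the sum of its restrictions to the even and to the odd dyadic scales, both of which have a
  rearrangement dominated by \<open>u\<close>; iterating, \<open>(8 / 7) ^ 6 \<ge> 2\<close> yields the dilation by \<open>2\<close>.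
\<close>

section \<open>The integrand of the modular\<close>

text \<open>Linearity would give the dilation by \<open>2\<close> in one step if the half-line split
  into two sets that each fill exactly half of every \<open>(0, x)\<close>, but the Lebesgue density
  theorem forbids such sets. Any proportion below \<open>1\<close> that is uniform in
  \<open>x\<close> serves instead, because dilations can be composed. Dyadic blocks provide one that
  works near \<open>0\<close> and near infinity alike.

  For boundedness, a closed graph argument would need completeness for a quasi-norm, and the
  quasi-triangle inequality itself rests on the bound sought. The contradiction is therefore
  assembled by hand from a countable supremum. Such a supremum need not be finite a priori, so
  decreasing functions take values in the extended half-line, and their finiteness on
  \<open>I\<close> is recovered afterwards from a finite modular.\<close>

lemma orlicz_nonneg: "orlicz_function \<phi> \<Longrightarrow> 0 \<le> x \<Longrightarrow> 0 \<le> \<phi> x"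
  by (simp add: orlicz_function_def)

lemma orlicz_zero: "orlicz_function \<phi> \<Longrightarrow> \<phi> 0 = 0"
  by (simp add: orlicz_function_def)

lemma orlicz_mono: "orlicz_function \<phi> \<Longrightarrow> 0 \<le> x \<Longrightarrow> x \<le> y \<Longrightarrow> \<phi> x \<le> \<phi> y"
  by (metis atLeast_iff dual_order.trans less_eq_real_def orlicz_function_def strict_mono_onD)

lemma orlicz_pos: "orlicz_function \<phi> \<Longrightarrow> 0 < x \<Longrightarrow> 0 < \<phi> x"
  by (metis atLeast_iff less_eq_real_def orlicz_function_def strict_mono_onD)

lemma orlicz_convex:
  assumes "orlicz_function \<phi>" "0 \<le> x" "0 \<le> y" "0 \<le> p" "0 \<le> q" "p + q = 1"
  shows "\<phi> (p * x + q * y) \<le> p * \<phi> x + q * \<phi> y"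
  using assms by (auto simp: orlicz_function_def convex_on_def)

text \<open>Convexity and \<open>\<phi> 0 = 0\<close> make \<open>\<phi> z / z\<close> at least
  \<open>\<phi> 1\<close> only beyond \<open>1\<close>; the shift by \<open>1\<close> makes the
  bound trivial on the rest. It supplies the growth at infinity.\<close>

lemma orlicz_ge_linear:
  assumes "orlicz_function \<phi>" "0 \<le> z"
  shows "\<phi> 1 * (z - 1) \<le> \<phi> z"
proof (cases "z \<le> 1")
  case True
  then have "\<phi> 1 * (z - 1) \<le> 0"
    using orlicz_nonneg[OF assms(1), of 1] by (intro mult_nonneg_nonpos) auto
  with orlicz_nonneg[OF assms] show ?thesis by simp
next
  case False
  have "\<phi> (1 / z * z + (1 - 1 / z) * 0) \<le> 1 / z * \<phi> z + (1 - 1 / z) * \<phi> 0"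
    using False by (intro orlicz_convex[OF assms(1)]) auto
  then have "\<phi> 1 \<le> \<phi> z / z"
    using False orlicz_zero[OF assms(1)] by simp
  then have "\<phi> 1 * z \<le> \<phi> z"
    using False by (simp add: field_simps)
  moreover have "\<phi> 1 * (z - 1) \<le> \<phi> 1 * z"
    using orlicz_nonneg[OF assms(1), of 1] by (simp add: algebra_simps)
  ultimately show ?thesis by simp
qed

lemma modular_integrand_top [simp]: "modular_integrand \<phi> \<infinity> v = \<infinity>" "modular_integrand \<phi> top v = top"
  by (auto simp: modular_integrand_def)

lemma modular_integrand_zero: "orlicz_function \<phi> \<Longrightarrow> modular_integrand \<phi> 0 v = 0"
  by (simp add: modular_integrand_def orlicz_zero)

lemma modular_integrand_eq_0:
  assumes "orlicz_function \<phi>" "0 \<le> v" "modular_integrand \<phi> x v = 0"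
  shows "x = 0"
proof (rule ccontr)
  assume "x \<noteq> 0"
  with assms(3) have "v \<noteq> 0" "x \<noteq> \<infinity>" and *: "\<phi> (enn2real x / v) * v \<le> 0"
    by (auto simp: modular_integrand_def ennreal_eq_0_iff split: if_splits)
  then have "0 < enn2real x"
    using \<open>x \<noteq> 0\<close> by (cases x) auto
  then have "0 < \<phi> (enn2real x / v) * v"
    using assms \<open>v \<noteq> 0\<close> by (intro mult_pos_pos orlicz_pos[OF assms(1)]) auto
  with * show False by simp
qed

lemma modular_integrand_mono:
  assumes "orlicz_function \<phi>" "0 \<le> v" "x \<le> y"
  shows "modular_integrand \<phi> x v \<le> modular_integrand \<phi> y v"
proof (cases "y = \<infinity>")
  case False
  then have "enn2real x \<le> enn2real y" "x \<noteq> \<infinity>"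
    using assms(3) by (auto simp: enn2real_mono less_top top_unique)
  then show ?thesis
    using assms False
    by (auto simp: modular_integrand_def intro!: ennreal_leI mult_right_mono orlicz_mono[OF assms(1)] divide_right_mono)
qed auto

text \<open>Positivity of both weights matters: an infinite term on the right must not be erased by
  a zero factor. For \<open>v = 0\<close> the combination vanishes only if \<open>x\<close> and
  \<open>y\<close> both do.\<close>

lemma modular_integrand_convex:
  assumes "orlicz_function \<phi>" "0 \<le> v" "0 < p" "0 < q" "p + q = 1"
  shows "modular_integrand \<phi> (ennreal p * x + ennreal q * y) v
    \<le> ennreal p * modular_integrand \<phi> x v + ennreal q * modular_integrand \<phi> y v"
proof (cases "x = \<infinity> \<or> y = \<infinity>")
  case True
  then show ?thesis using assms by (auto simp: ennreal_mult_top)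
next
  case False
  then obtain x' y' where xy: "x = ennreal x'" "y = ennreal y'" "0 \<le> x'" "0 \<le> y'"
    by (cases x; cases y) auto
  have eq: "ennreal p * x + ennreal q * y = ennreal (p * x' + q * y')"
    using xy assms by (simp flip: ennreal_plus ennreal_mult)
  show ?thesis
  proof (cases "v = 0")
    case True
    then show ?thesis using assms xy
      by (auto simp: modular_integrand_def ennreal_mult_top)
  next
    case False
    with assms have "0 < v" by auto
    have "\<phi> (p * (x' / v) + q * (y' / v)) \<le> p * \<phi> (x' / v) + q * \<phi> (y' / v)"
      using assms xy by (intro orlicz_convex[OF assms(1)]) auto
    from mult_right_mono[OF this assms(2)]
    have "\<phi> ((p * x' + q * y') / v) * v \<le> p * (\<phi> (x' / v) * v) + q * (\<phi> (y' / v) * v)"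
      by (simp add: add_divide_distrib distrib_right mult.assoc)
    then have "ennreal (\<phi> ((p * x' + q * y') / v) * v)
      \<le> ennreal (p * (\<phi> (x' / v) * v) + q * (\<phi> (y' / v) * v))"
      by (rule ennreal_leI)
    also have "0 \<le> \<phi> (x' / v) * v" "0 \<le> \<phi> (y' / v) * v"
      using assms xy by (auto intro!: mult_nonneg_nonneg orlicz_nonneg[OF assms(1)])
    then have "ennreal (p * (\<phi> (x' / v) * v) + q * (\<phi> (y' / v) * v))
      = ennreal p * ennreal (\<phi> (x' / v) * v) + ennreal q * ennreal (\<phi> (y' / v) * v)"
      using assms by (simp add: ennreal_plus ennreal_mult)
    finally have "ennreal (\<phi> ((p * x' + q * y') / v) * v)
      \<le> ennreal p * ennreal (\<phi> (x' / v) * v) + ennreal q * ennreal (\<phi> (y' / v) * v)" .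
    then show ?thesis
      unfolding eq using assms xy \<open>0 < v\<close> by (simp add: modular_integrand_def del: ennreal_plus)
  qed
qed

lemma modular_integrand_unbounded:
  assumes "orlicz_function \<phi>" "0 \<le> v" "(SUP n::nat. x n) = \<infinity>"
  shows "(SUP n. modular_integrand \<phi> (x n) v) = \<infinity>"
  unfolding infinity_ennreal_def SUP_eq_top_iff
proof safe
  fix b :: ennreal assume "b < top"
  then obtain b' where b: "b = ennreal b'" "0 \<le> b'" by (cases b) auto
  have p1: "0 < \<phi> 1" using assms(1) by (simp add: orlicz_pos)
  \<comment> \<open>The threshold solves \<open>\<phi> 1 * (y - v) = b'\<close>, the linear lower
    bound for the integrand at a finite value \<open>y\<close>. For \<open>v = 0\<close> only its
    non-negativity is used.\<close>
  have "ennreal (v + b' / \<phi> 1) < (SUP n. x n)" by (simp add: assms(3))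
  then obtain n where n: "ennreal (v + b' / \<phi> 1) < x n" by (auto simp: less_SUP_iff)
  have pos: "0 \<le> v + b' / \<phi> 1" using assms b p1 by auto
  show "\<exists>i\<in>UNIV. b < modular_integrand \<phi> (x i) v"
  proof (intro bexI[of _ n])
    show "b < modular_integrand \<phi> (x n) v"
    proof (cases "x n")
      case (real y)
      with n pos have y: "v + b' / \<phi> 1 < y" by (simp add: ennreal_less_iff)
      show ?thesis
      proof (cases "v = 0")
        case True
        then show ?thesis using n b by (auto simp: modular_integrand_def)
      next
        case False
        with assms have v: "0 < v" by auto
        have "b' < \<phi> 1 * (y - v)" using y p1 by (simp add: field_simps)
        also have "\<dots> = \<phi> 1 * (y / v - 1) * v" using v by (simp add: field_simps)
        also have "\<dots> \<le> \<phi> (y / v) * v"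
          using v real by (intro mult_right_mono orlicz_ge_linear[OF assms(1)]) auto
        finally show ?thesis
          using False real b by (simp add: modular_integrand_def ennreal_less_iff)
      qed
    qed (use b in auto)
  qed auto
qed

text \<open>The factor \<open>1/2\<close> makes the continuity of \<open>\<phi>\<close> unnecessary.\<close>

lemma modular_integrand_half_SUP:
  assumes "orlicz_function \<phi>" "0 \<le> v"
  shows "modular_integrand \<phi> (ennreal (1/2) * (SUP n::nat. x n)) v \<le> (SUP n. modular_integrand \<phi> (x n) v)"
proof -
  consider "(SUP n. x n) = 0" | "(SUP n. x n) = \<infinity>" | s where "0 < s" "(SUP n. x n) = ennreal s"
    by (cases "SUP n. x n") (auto simp: less_le)
  then show ?thesis
  proof cases
    case 1
    then show ?thesis using assms by (simp add: modular_integrand_zero)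
  next
    case 2
    show ?thesis unfolding modular_integrand_unbounded[OF assms 2] by (simp add: top_greatest)
  next
    case 3
    have le: "ennreal (1/2) * (SUP n. x n) = ennreal (s/2)"
      unfolding 3 by (subst ennreal_mult[symmetric]) (use 3 in auto)
    also have "\<dots> < (SUP n. x n)"
      using 3 by (simp add: ennreal_less_iff)
    finally obtain n where "ennreal (1/2) * (SUP n. x n) < x n" by (auto simp: less_SUP_iff)
    then have "modular_integrand \<phi> (ennreal (1/2) * (SUP n. x n)) v \<le> modular_integrand \<phi> (x n) v"
      using assms by (intro modular_integrand_mono) auto
    also have "\<dots> \<le> (SUP n. modular_integrand \<phi> (x n) v)" by (rule SUP_upper) simp
    finally show ?thesis .
  qed
qed

lemma measurable_modular_integrand:
  assumes \<phi>: "orlicz_function \<phi>" and [measurable]: "u \<in> borel_measurable M" "w \<in> borel_measurable M"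
    and w: "\<And>t. t \<in> space M \<Longrightarrow> 0 \<le> w t"
  shows "(\<lambda>t. modular_integrand \<phi> (u t) (w t)) \<in> borel_measurable M"
proof -
  \<comment> \<open>\<open>\<phi>\<close> is constrained only on the non-negative reals. Continued
    by \<open>\<phi> 0\<close> to the left it is monotone on the whole line, hence Borel, and the
    integrand only evaluates it where both agree.\<close>
  define \<psi> where "\<psi> = (\<lambda>x. \<phi> (max 0 x))"
  have "mono \<psi>"
    unfolding \<psi>_def by (intro monoI orlicz_mono[OF \<phi>]) auto
  then have [measurable]: "\<psi> \<in> borel_measurable borel"
    by (rule borel_measurable_mono)
  have "(\<lambda>t. if u t = \<infinity> then \<infinity> else if w t = 0 then (if u t = 0 then 0 else \<infinity>)
      else ennreal (\<psi> (enn2real (u t) / w t) * w t)) \<in> borel_measurable M"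
    by measurable
  also have "?this \<longleftrightarrow> ?thesis"
    by (intro measurable_cong) (use w in \<open>simp add: modular_integrand_def \<psi>_def\<close>)
  finally show ?thesis .
qed

section \<open>Rearrangements\<close>

text \<open>Monotonicity and right-continuity in one condition: \<open>r\<close> ranges over all points left of \<open>t'\<close>, not
  only over those near \<open>t\<close>.\<close>

definition decreasing_rc :: "real set \<Rightarrow> (real \<Rightarrow> ennreal) \<Rightarrow> bool" where
  "decreasing_rc I u \<longleftrightarrow> (\<forall>t\<in>I. \<forall>s<u t. \<exists>t'>t. \<forall>r\<in>I. r < t' \<longrightarrow> s < u r)"

lemma decreasing_rcD:
  assumes "decreasing_rc I u" "t \<in> I" "s < u t"
  obtains t' where "t < t'" "\<And>r. r \<in> I \<Longrightarrow> r < t' \<Longrightarrow> s < u r"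
  using assms by (meson decreasing_rc_def)

lemma decreasing_rc_antimono:
  assumes "decreasing_rc I u" "t \<in> I" "r \<in> I" "r \<le> t"
  shows "u t \<le> u r"
proof (rule ccontr)
  assume "\<not> u t \<le> u r"
  then have "u r < u t" by simp
  from decreasing_rcD[OF assms(1,2) this] obtain t'
    where "t < t'" "\<And>r'. r' \<in> I \<Longrightarrow> r' < t' \<Longrightarrow> u r < u r'" by blast
  from this(2)[of r] this(1) assms show False by auto
qed

text \<open>A strict lower bound on a supremum is already a strict lower bound on one member, whose
  \<open>t'\<close> then serves for the supremum.\<close>

lemma decreasing_rc_SUP: "(\<And>n. decreasing_rc I (u n)) \<Longrightarrow> decreasing_rc I (\<lambda>t. SUP n. u n t)"
  unfolding decreasing_rc_def less_SUP_iff by (meson UNIV_I)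

lemma decreasing_rc_scale:
  assumes u: "decreasing_rc I u" and c: "0 < c"
  shows "decreasing_rc I (\<lambda>t. ennreal c * u t)"
  unfolding decreasing_rc_def
proof (intro ballI allI impI)
  fix t s assume "t \<in> I" and s: "s < ennreal c * u t"
  have iff: "s < ennreal c * x \<longleftrightarrow> s / ennreal c < x" for x
    using c by (subst divide_less_ennreal) (auto simp: mult.commute)
  from u \<open>t \<in> I\<close> s show "\<exists>t'>t. \<forall>r\<in>I. r < t' \<longrightarrow> s < ennreal c * u r"
    unfolding iff by (metis decreasing_rcD)
qed

section \<open>Dilation of measurable functions and sets\<close>

lemma measurable_halve: "(\<lambda>t::real. t / 2) \<in> lebesgue \<rightarrow>\<^sub>M lebesgue"
proof -
  have "(\<lambda>t::real. t / 2) = (*\<^sub>R) (1 / 2)"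
    by (simp add: fun_eq_iff)
  then show ?thesis
    using lebesgue_measurable_scaling[of "1 / 2"] by simp
qed

lemma D2_measurable:
  assumes "f \<in> L0 I" "I \<in> sets lebesgue" "\<And>t. t \<in> I \<Longrightarrow> t / 2 \<in> I"
  shows "D2 f \<in> L0 I"
proof -
  have "(\<lambda>t. t / 2) \<in> lebesgue_on I \<rightarrow>\<^sub>M lebesgue"
    by (rule measurable_restrict_space1[OF measurable_halve])
  then have "(\<lambda>t. t / 2) \<in> lebesgue_on I \<rightarrow>\<^sub>M lebesgue_on I"
    by (rule measurable_restrict_space2[rotated]) (use assms(3) in \<open>auto simp: space_restrict_space\<close>)
  with assms(1) show ?thesis
    unfolding L0_def D2_def by (rule measurable_compose[rotated])
qed

lemma emeasure_dilate:
  assumes "A \<in> sets lebesgue"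
  shows "emeasure lebesgue ((*) 2 ` A) = 2 * emeasure lebesgue (A::real set)" "(*) 2 ` A \<in> sets lebesgue"
proof -
  show "emeasure lebesgue ((*) 2 ` A) = 2 * emeasure lebesgue A"
    using emeasure_lebesgue_affine[of 2 0 A] by simp
  have "(*) 2 ` A = (\<lambda>t. t / 2) -` A \<inter> space lebesgue"
    by (auto intro!: image_eqI[of _ _ "_ / 2"])
  also have "\<dots> \<in> sets lebesgue"
    by (rule measurable_sets[OF measurable_halve assms])
  finally show "(*) 2 ` A \<in> sets lebesgue" .
qed

text \<open>Rearrangements and norms are both infima, so this reduces the triangle inequality for
  either to members of the two sets. The members within \<open>e/2\<close> exist because the infima
  may be assumed finite.\<close>

lemma le_Inf_add_Inf_ennreal:
  fixes A B :: "ennreal set"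
  assumes "\<And>x y. x \<in> A \<Longrightarrow> y \<in> B \<Longrightarrow> z \<le> x + y"
  shows "z \<le> Inf A + Inf B"
proof (rule ennreal_le_epsilon)
  fix e :: real assume fin: "Inf A + Inf B < top" and e: "0 < e"
  have gt: "c < c + ennreal (e/2)" if "c < top" for c
    using that e by (cases c) (auto simp: ennreal_less_iff simp flip: ennreal_plus)
  from fin have "Inf A < Inf A + ennreal (e/2)" "Inf B < Inf B + ennreal (e/2)"
    by (intro gt; simp only: ennreal_add_less_top)+
  then obtain x y where xy: "x \<in> A" "x < Inf A + ennreal (e/2)" "y \<in> B" "y < Inf B + ennreal (e/2)"
    unfolding Inf_less_iff by blast
  then have "z \<le> (Inf A + ennreal (e/2)) + (Inf B + ennreal (e/2))"
    using assms[of x y] by (meson add_mono less_imp_le order_trans)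
  also have "\<dots> = Inf A + Inf B + (ennreal (e/2) + ennreal (e/2))" by (simp add: ac_simps)
  also have "\<dots> = Inf A + Inf B + ennreal e" using e by (simp flip: ennreal_plus)
  finally show "z \<le> Inf A + Inf B + ennreal e" .
qed

lemma le_mult_Inf_ennreal:
  fixes A :: "ennreal set"
  assumes "0 < c" "\<And>x. x \<in> A \<Longrightarrow> z \<le> ennreal c * x"
  shows "z \<le> ennreal c * Inf A"
proof -
  have cancel: "ennreal (1 / c) * (ennreal c * x) = x" "ennreal c * (ennreal (1 / c) * x) = x" for x
    using assms(1) by (simp_all flip: mult.assoc ennreal_mult)
  have "ennreal (1 / c) * z \<le> Inf A"
    using assms(2) cancel(1) by (intro Inf_greatest) (metis mult_left_mono zero_le)
  then show ?thesis
    using cancel(2) by (metis mult_left_mono zero_le)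
qed

section \<open>Initial intervals and decreasing functions on them\<close>

locale initial_interval =
  fixes a :: ereal and I :: "real set"
  assumes a_pos: "0 < a" and I_eq: "I = einterval 0 a"
begin

lemma I_pos: "t \<in> I \<Longrightarrow> 0 < t"
  by (auto simp: I_eq einterval_iff)

lemma I_down: "t \<in> I \<Longrightarrow> 0 < r \<Longrightarrow> r \<le> t \<Longrightarrow> r \<in> I"
  by (auto simp: I_eq einterval_iff intro: le_less_trans[of "ereal r" "ereal t"])

lemma I_divide: "t \<in> I \<Longrightarrow> 1 \<le> k \<Longrightarrow> t / k \<in> I"
  using I_pos[of t] mult_left_mono[of 1 k t] by (intro I_down[of t "t / k"]) (simp_all add: divide_le_eq)

lemma I_nonempty: "I \<noteq> {}"
proof -
  obtain r where "ereal 0 < ereal r" "ereal r < a"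
    using a_pos ereal_dense2[of 0 a] by (auto simp: zero_ereal_def)
  then show ?thesis by (auto simp: I_eq einterval_iff)
qed

text \<open>The right end of \<open>I\<close> is excluded, so right-continuity at \<open>t\<close>
  always has room to act inside \<open>I\<close>.\<close>

lemma I_larger:
  assumes "t \<in> I" "t < t'"
  obtains r where "r \<in> I" "t < r" "r < t'"
proof -
  have "ereal t < min a (ereal t')" using assms by (auto simp: I_eq einterval_iff)
  then obtain r where "ereal t < ereal r" "ereal r < min a (ereal t')"
    using ereal_dense2 by blast
  moreover from this have "r \<in> I" using assms by (auto simp: I_eq einterval_iff dest: less_trans)
  ultimately show thesis using that by auto
qed

lemma I_sets [measurable]: "I \<in> sets lebesgue" "I \<in> sets borel"
  by (auto simp: I_eq)

lemma space_I [simp]: "space (lebesgue_on I) = I"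
  by (simp add: space_restrict_space)

text \<open>\<open>(0, t)\<close> has positive measure and cannot consist of exceptional points. For
  decreasing functions a good point to the left of \<open>t\<close> controls the value at
  \<open>t\<close>.\<close>

lemma AE_I_less:
  assumes "AE t in lebesgue_on I. P t" "t \<in> I"
  obtains r where "r \<in> I" "r < t" "P r"
proof -
  have "AE r in lebesgue. r \<in> I \<longrightarrow> P r"
    using assms(1) by (subst (asm) AE_restrict_space_iff) auto
  moreover have "\<not> (AE r in lebesgue. r \<notin> {0<..<t})"
  proof
    assume "AE r in lebesgue. r \<notin> {0<..<t}"
    then have "emeasure lebesgue {0<..<t} = 0"
      by (subst (asm) AE_iff_null_sets[symmetric]) auto
    with I_pos[OF assms(2)] show False by simp
  qed
  ultimately have "\<exists>r. r \<in> {0<..<t} \<and> (r \<in> I \<longrightarrow> P r)"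
    by (metis (mono_tags, lifting) AE_mp AE_I2)
  with that I_down[OF assms(2)] show thesis by fastforce
qed

lemma decreasing_rc_dilate:
  assumes u: "decreasing_rc I u" and k: "1 \<le> k"
  shows "decreasing_rc I (\<lambda>t. u (t / k))"
  unfolding decreasing_rc_def
proof (intro ballI allI impI)
  fix t s assume t: "t \<in> I" and s: "s < u (t / k)"
  from decreasing_rcD[OF u I_divide[OF t k] s] obtain t'
    where t': "t / k < t'" "\<And>r. r \<in> I \<Longrightarrow> r < t' \<Longrightarrow> s < u r" by blast
  show "\<exists>t'>t. \<forall>r\<in>I. r < t' \<longrightarrow> s < u (r / k)"
    using t' k I_divide[OF _ k] by (intro exI[of _ "k * t'"]) (auto simp: field_simps)
qed

lemma decreasing_rc_measurable:
  assumes "decreasing_rc I u"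
  shows "u \<in> borel_measurable (lebesgue_on I)"
proof (rule borel_measurableI_greater)
  fix s
  \<comment> \<open>Every witness \<open>t'\<close> yields an open ray on which \<open>u\<close>
    exceeds \<open>s\<close> within \<open>I\<close>, so the superlevel set is the trace of an open
    set.\<close>
  define U where "U = (\<Union>t\<in>{t \<in> I. s < u t}. \<Union>t'\<in>{t'. t < t' \<and> (\<forall>r\<in>I. r < t' \<longrightarrow> s < u r)}. {..<t'})"
  have "open U" unfolding U_def by (intro open_UN ballI open_lessThan)
  then have U: "U \<in> sets lebesgue" by auto
  have "{t \<in> space (lebesgue_on I). s < u t} = U \<inter> I"
    using assms unfolding U_def decreasing_rc_def by auto
  then show "{t \<in> space (lebesgue_on I). s < u t} \<in> sets (lebesgue_on I)"
    using U by (auto simp: sets_restrict_space_iff)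
qed

section \<open>Distribution functions and rearrangements\<close>

lemma level_set_measurable:
  assumes "f \<in> L0 I"
  shows "{t \<in> I. s < \<bar>f t\<bar>} \<in> sets lebesgue"
proof -
  have [measurable]: "f \<in> borel_measurable (lebesgue_on I)" using assms by (simp add: L0_def)
  have "{t \<in> space (lebesgue_on I). s < \<bar>f t\<bar>} \<in> sets (lebesgue_on I)" by measurable
  then show ?thesis by (simp add: sets_restrict_space_iff)
qed

lemma distribution_fun_antimono:
  assumes "f \<in> L0 I" "s \<le> s'"
  shows "distribution_fun I f s' \<le> distribution_fun I f s"
  unfolding distribution_fun_def
  using assms level_set_measurable by (intro emeasure_mono) auto

lemma rearrangement_le:
  "0 \<le> s \<Longrightarrow> distribution_fun I f s \<le> ennreal t \<Longrightarrow> rearrangement I f t \<le> ennreal s"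
  unfolding rearrangement_def by (intro Inf_lower) auto

lemma rearrangement_lessE:
  assumes "rearrangement I f t < x"
  obtains s where "0 \<le> s" "ennreal s < x" "distribution_fun I f s \<le> ennreal t"
  using assms unfolding rearrangement_def Inf_less_iff by auto

lemma rearrangement_decreasing_rc:
  assumes f: "f \<in> L0 I"
  shows "decreasing_rc I (rearrangement I f)"
  unfolding decreasing_rc_def
proof (intro ballI allI impI)
  fix t s assume t: "t \<in> I" and s: "s < rearrangement I f t"
  \<comment> \<open>The infimum defining the rearrangement is not assumed to be attained; the gap
    between \<open>s\<close> and \<open>r\<close> provides an actual level \<open>q\<close> below
    \<open>r\<close>. The point \<open>t'\<close> then comes from the gap between \<open>t\<close>
    and the measure of the level set at \<open>r\<close>.\<close>
  from dense[OF s] obtain r' where r': "s < r'" "r' < rearrangement I f t" by blast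
  then obtain r where r: "0 \<le> r" "r' = ennreal r" by (cases r') auto
  have "ennreal t < distribution_fun I f r"
    using rearrangement_le[OF r(1), of f t] r' r by (meson leD not_le)
  from dense[OF this] obtain x where "ennreal t < x" "x < distribution_fun I f r" by blast
  then obtain t' where t': "ennreal t < ennreal t'" "ennreal t' < distribution_fun I f r" "0 \<le> t'"
    by (cases x) auto
  have "s < rearrangement I f p" if "p \<in> I" "p < t'" for p
  proof (rule ccontr)
    assume "\<not> s < rearrangement I f p"
    then have "rearrangement I f p < ennreal r" using r' r by auto
    then obtain q where q: "0 \<le> q" "ennreal q < ennreal r" "distribution_fun I f q \<le> ennreal p"
      by (rule rearrangement_lessE)
    then have "distribution_fun I f r \<le> distribution_fun I f q"
      using r by (intro distribution_fun_antimono f) (auto simp: ennreal_less_iff)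
    also have "\<dots> \<le> ennreal p" by fact
    also have "\<dots> \<le> ennreal t'" using that by (simp add: ennreal_leI)
    finally show False using t' by auto
  qed
  moreover have "t < t'" using t' I_pos[OF t] by (simp add: ennreal_less_iff)
  ultimately show "\<exists>t'>t. \<forall>p\<in>I. p < t' \<longrightarrow> s < rearrangement I f p" by blast
qed

lemma rearrangement_zero: "t \<in> I \<Longrightarrow> rearrangement I (\<lambda>_. 0) t = 0"
  using rearrangement_le[of 0 "\<lambda>_. 0" t] by (simp add: distribution_fun_def)

lemma rearrangement_scale_le:
  assumes "c \<noteq> 0"
  shows "rearrangement I (\<lambda>t. c * f t) t \<le> ennreal \<bar>c\<bar> * rearrangement I f t"
  unfolding rearrangement_def[of I f]
proof (rule le_mult_Inf_ennreal, use assms in simp, safe)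
  fix s :: real assume s: "0 \<le> s" "distribution_fun I f s \<le> ennreal t"
  have "distribution_fun I (\<lambda>t. c * f t) (\<bar>c\<bar> * s) = distribution_fun I f s"
    using assms by (simp add: distribution_fun_def abs_mult)
  then have "rearrangement I (\<lambda>t. c * f t) t \<le> ennreal (\<bar>c\<bar> * s)"
    using s by (intro rearrangement_le) auto
  then show "rearrangement I (\<lambda>t. c * f t) t \<le> ennreal \<bar>c\<bar> * ennreal s"
    using s by (simp add: ennreal_mult)
qed

lemma rearrangement_scale:
  assumes "c \<noteq> 0"
  shows "rearrangement I (\<lambda>t. c * f t) t = ennreal \<bar>c\<bar> * rearrangement I f t"
proof (rule antisym[OF rearrangement_scale_le[OF assms]])
  have "rearrangement I (\<lambda>t. 1 / c * (c * f t)) t \<le> ennreal \<bar>1 / c\<bar> * rearrangement I (\<lambda>t. c * f t) t"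
    using assms by (intro rearrangement_scale_le) auto
  then have "ennreal \<bar>c\<bar> * rearrangement I f t
      \<le> ennreal \<bar>c\<bar> * (ennreal \<bar>1 / c\<bar> * rearrangement I (\<lambda>t. c * f t) t)"
    using assms by (intro mult_left_mono) auto
  also have "\<dots> = rearrangement I (\<lambda>t. c * f t) t"
    using assms by (simp flip: mult.assoc ennreal_mult abs_mult)
  finally show "ennreal \<bar>c\<bar> * rearrangement I f t \<le> rearrangement I (\<lambda>t. c * f t) t" .
qed

text \<open>\<open>\<bar>f + g\<bar>\<close> can exceed \<open>s1 + s2\<close> only where
  \<open>\<bar>f\<bar>\<close> exceeds \<open>s1\<close> or \<open>\<bar>g\<bar>\<close> exceeds
  \<open>s2\<close>. Allotting half of the measure \<open>t\<close> to each exceptional set is what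
  brings in the dilation.\<close>

lemma rearrangement_add:
  assumes f: "f \<in> L0 I" and g: "g \<in> L0 I" and t: "t \<in> I"
  shows "rearrangement I (\<lambda>t. f t + g t) t \<le> rearrangement I f (t / 2) + rearrangement I g (t / 2)"
proof -
  have *: "rearrangement I (\<lambda>t. f t + g t) t \<le> ennreal s1 + ennreal s2"
    if s1: "0 \<le> s1" "distribution_fun I f s1 \<le> ennreal (t / 2)"
      and s2: "0 \<le> s2" "distribution_fun I g s2 \<le> ennreal (t / 2)" for s1 s2
  proof -
    have "distribution_fun I (\<lambda>t. f t + g t) (s1 + s2)
        \<le> emeasure lebesgue ({t \<in> I. s1 < \<bar>f t\<bar>} \<union> {t \<in> I. s2 < \<bar>g t\<bar>})"
      unfolding distribution_fun_def
      using level_set_measurable[OF f] level_set_measurable[OF g] by (intro emeasure_mono) auto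
    also have "\<dots> \<le> distribution_fun I f s1 + distribution_fun I g s2"
      unfolding distribution_fun_def
      by (intro emeasure_subadditive level_set_measurable f g)
    also have "\<dots> \<le> ennreal (t / 2) + ennreal (t / 2)"
      using s1 s2 by (intro add_mono)
    also have "\<dots> = ennreal t" using I_pos[OF t] by (simp flip: ennreal_plus)
    finally have "rearrangement I (\<lambda>t. f t + g t) t \<le> ennreal (s1 + s2)"
      using s1 s2 by (intro rearrangement_le) auto
    then show ?thesis using s1 s2 by simp
  qed
  show ?thesis
    unfolding rearrangement_def[of I f] rearrangement_def[of I g]
    by (rule le_Inf_add_Inf_ennreal) (use * in auto)
qed

text \<open>Only an inequality in general: when \<open>a\<close> is finite, the dilated level set
  can stick out of \<open>I\<close>.\<close>

lemma rearrangement_D2_le: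
  assumes f: "f \<in> L0 I" and t: "t \<in> I"
  shows "rearrangement I (D2 f) t \<le> rearrangement I f (t / 2)"
  unfolding rearrangement_def[of I f]
proof (rule Inf_greatest, safe)
  fix s :: real assume s: "0 \<le> s" "distribution_fun I f s \<le> ennreal (t / 2)"
  note meas = emeasure_dilate[OF level_set_measurable[OF f, of s]]
  have "{t \<in> I. s < \<bar>D2 f t\<bar>} \<subseteq> (*) 2 ` {t \<in> I. s < \<bar>f t\<bar>}"
  proof
    fix r assume "r \<in> {t \<in> I. s < \<bar>D2 f t\<bar>}"
    then show "r \<in> (*) 2 ` {t \<in> I. s < \<bar>f t\<bar>}"
      using I_divide[of r 2] by (intro image_eqI[of _ _ "r/2"]) (auto simp: D2_def)
  qed
  then have "distribution_fun I (D2 f) s \<le> 2 * distribution_fun I f s"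
    unfolding distribution_fun_def meas(1)[symmetric] using meas(2) by (rule emeasure_mono)
  also have "\<dots> \<le> 2 * ennreal (t / 2)" using s by (intro mult_left_mono) auto
  also have "\<dots> = ennreal t" using I_pos[OF t] by (simp flip: ennreal_numeral ennreal_mult)
  finally show "rearrangement I (D2 f) t \<le> ennreal s" using s by (intro rearrangement_le)
qed

lemma enn2real_L0: "decreasing_rc I u \<Longrightarrow> (\<lambda>t. enn2real (u t)) \<in> L0 I"
  unfolding L0_def by (intro borel_measurable_enn2real decreasing_rc_measurable)

text \<open>Monotonicity confines the set where \<open>u\<close> exceeds \<open>u t\<close> to
  \<open>(0, t)\<close>. Conversely, if \<open>s < u t\<close>, right-continuity keeps
  \<open>u\<close> above \<open>s\<close> on an interval longer than \<open>t\<close>, so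
  \<open>s\<close> is not a competitor in the infimum.\<close>

lemma rearrangement_enn2real:
  assumes u: "decreasing_rc I u" and fin: "\<And>t. t \<in> I \<Longrightarrow> u t < \<infinity>" and t: "t \<in> I"
  shows "rearrangement I (\<lambda>t. enn2real (u t)) t = u t"
proof (rule antisym)
  have t0: "0 < t" using t by (rule I_pos)
  have "{r \<in> I. enn2real (u t) < \<bar>enn2real (u r)\<bar>} \<subseteq> {0..t}"
  proof safe
    fix r assume r: "r \<in> I" "enn2real (u t) < \<bar>enn2real (u r)\<bar>"
    have "\<not> t \<le> r"
    proof
      assume "t \<le> r"
      then have "u r \<le> u t" by (rule decreasing_rc_antimono[OF u r(1) t])
      then have "enn2real (u r) \<le> enn2real (u t)" using fin[OF t] by (intro enn2real_mono) auto
      then show False using r by auto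
    qed
    then show "r \<in> {0..t}" using I_pos[OF r(1)] by auto
  qed
  then have "distribution_fun I (\<lambda>t. enn2real (u t)) (enn2real (u t)) \<le> emeasure lebesgue {0..t}"
    unfolding distribution_fun_def by (intro emeasure_mono) auto
  then have "rearrangement I (\<lambda>t. enn2real (u t)) t \<le> ennreal (enn2real (u t))"
    using t0 by (intro rearrangement_le) auto
  then show "rearrangement I (\<lambda>t. enn2real (u t)) t \<le> u t"
    using fin[OF t] by simp
  show "u t \<le> rearrangement I (\<lambda>t. enn2real (u t)) t"
    unfolding rearrangement_def
  proof (rule Inf_greatest, safe, rule ccontr)
    fix s :: real assume s: "0 \<le> s" "distribution_fun I (\<lambda>t. enn2real (u t)) s \<le> ennreal t"
    assume "\<not> u t \<le> ennreal s"
    then have "ennreal s < u t" by simp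
    from decreasing_rcD[OF u t this] obtain t' where t': "t < t'"
      "\<And>r. r \<in> I \<Longrightarrow> r < t' \<Longrightarrow> ennreal s < u r" by blast
    from I_larger[OF t t'(1)] obtain p where p: "p \<in> I" "t < p" "p < t'" .
    have "{0<..<p} \<subseteq> {r \<in> I. s < \<bar>enn2real (u r)\<bar>}"
    proof
      fix r assume r: "r \<in> {0<..<p}"
      then have I: "r \<in> I" using I_down[OF p(1), of r] by auto
      with t'(2)[of r] r p fin[OF I] have "s < enn2real (u r)"
        using s by (cases "u r") (auto simp: ennreal_less_iff)
      with I show "r \<in> {r \<in> I. s < \<bar>enn2real (u r)\<bar>}" by auto
    qed
    then have "emeasure lebesgue {0<..<p} \<le> distribution_fun I (\<lambda>t. enn2real (u t)) s"
      unfolding distribution_fun_def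
      by (intro emeasure_mono level_set_measurable enn2real_L0 u)
    with s(2) have "emeasure lebesgue {0<..<p} \<le> ennreal t" by (rule order_trans[rotated])
    with p t0 show False by simp
  qed
qed

text \<open>A level set of measure above \<open>e > 0\<close> keeps the rearrangement away from
  \<open>0\<close> on the part of \<open>(0, e)\<close> in \<open>I\<close>, and the countably many
  levels \<open>1 / Suc n\<close> exhaust the set where \<open>f\<close> is nonzero.\<close>

lemma rearrangement_eq_0_iff:
  assumes f: "f \<in> L0 I"
  shows "(AE t in lebesgue_on I. rearrangement I f t = 0) \<longleftrightarrow> (AE t in lebesgue_on I. f t = 0)"
proof
  assume ae: "AE t in lebesgue_on I. rearrangement I f t = 0"
  have "distribution_fun I f s = 0" if s: "0 < s" for s
  proof (rule ccontr)
    assume "distribution_fun I f s \<noteq> 0"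
    then have "0 < distribution_fun I f s" by (simp add: zero_less_iff_neq_zero)
    from dense[OF this] obtain x where "0 < x" "x < distribution_fun I f s" by blast
    then obtain e where e: "0 < e" "ennreal e < distribution_fun I f s"
      by (cases x) auto
    obtain p where p: "p \<in> I" using I_nonempty by auto
    \<comment> \<open>\<open>e\<close> itself may lie outside \<open>I\<close>;
      \<open>min e p\<close> does not, and every point below it is still below
      \<open>e\<close>.\<close>
    then have "min e p \<in> I" using e I_pos by (intro I_down[OF p]) auto
    from AE_I_less[OF ae this] obtain r where r: "r \<in> I" "r < min e p" "rearrangement I f r = 0" .
    then have "rearrangement I f r < ennreal s" using s by simp
    then obtain q where q: "0 \<le> q" "ennreal q < ennreal s" "distribution_fun I f q \<le> ennreal r"
      by (rule rearrangement_lessE)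
    then have "distribution_fun I f s \<le> distribution_fun I f q"
      by (intro distribution_fun_antimono f) (auto simp: ennreal_less_iff)
    also have "\<dots> \<le> ennreal e" using q(3) r(2) by (meson ennreal_leI less_imp_le min.strict_boundedE order_trans)
    finally show False using e by auto
  qed
  then have "emeasure lebesgue {t \<in> I. 1 / real (Suc n) < \<bar>f t\<bar>} = 0" for n
    by (simp add: distribution_fun_def)
  then have "AE t in lebesgue. t \<notin> {t \<in> I. 1 / real (Suc n) < \<bar>f t\<bar>}" for n
    by (intro AE_not_in null_setsI level_set_measurable f)
  then have "AE t in lebesgue. \<forall>n. t \<notin> {t \<in> I. 1 / real (Suc n) < \<bar>f t\<bar>}"
    unfolding AE_all_countable by blast
  then have "AE t in lebesgue. t \<in> I \<longrightarrow> f t = 0"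
  proof (rule AE_mp, intro AE_I2 impI)
    fix t assume "\<forall>n. t \<notin> {t \<in> I. 1 / real (Suc n) < \<bar>f t\<bar>}" "t \<in> I"
    then show "f t = 0"
      using nat_approx_posE[of "\<bar>f t\<bar>"] by (cases "f t = 0") auto
  qed
  then show "AE t in lebesgue_on I. f t = 0"
    by (subst AE_restrict_space_iff) auto
next
  assume "AE t in lebesgue_on I. f t = 0"
  then have "AE t in lebesgue. t \<in> I \<longrightarrow> f t = 0"
    by (subst (asm) AE_restrict_space_iff) auto
  then have "distribution_fun I f 0 = 0"
    using emeasure_eq_0_AE[of "\<lambda>t. t \<in> I \<and> 0 < \<bar>f t\<bar>" lebesgue] by (simp add: distribution_fun_def)
  then have "rearrangement I f t = 0" for t
    using rearrangement_le[of 0 f t] by simp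
  then show "AE t in lebesgue_on I. rearrangement I f t = 0" by simp
qed

end

lemma ennreal_scale_scale: "0 \<le> p \<Longrightarrow> 0 \<le> q \<Longrightarrow> ennreal p * (ennreal q * x) = ennreal (p * q) * x"
  by (simp add: ennreal_mult mult.assoc)

section \<open>Splitting by dyadic scales\<close>

lemma dyadic_gap:
  assumes x: "(0::real) < x"
  obtains l where "0 < l" "2 * l \<le> x" "x \<le> 8 * l" "\<And>t. l \<le> t \<Longrightarrow> t < 2 * l \<Longrightarrow> even \<lfloor>log 2 t\<rfloor> = b"
proof -
  define k where "k = \<lfloor>log 2 x\<rfloor>"
  \<comment> \<open>Block \<open>k - 1\<close> is the last one that surely fits below
    \<open>x\<close>, and block \<open>k - 2\<close> has the other parity. Since
    \<open>x < 2 powr (k + 1)\<close>, the chosen block starts at no less than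
    \<open>x / 8\<close>.\<close>
  define j where "j = (if even (k - 1) = b then k - 1 else k - 2)"
  have j: "even j = b" "j + 1 \<le> k" "k \<le> j + 2" by (auto simp: j_def)
  define l where "l = 2 powr real_of_int j"
  have 2: "2 * l = 2 powr (real_of_int j + 1)" by (simp add: l_def powr_add)
  have 8: "8 * l = 2 powr (real_of_int j + 3)" by (simp add: l_def powr_add)
  have "real_of_int j + 1 \<le> log 2 x" "log 2 x \<le> real_of_int j + 3"
    using j unfolding k_def by linarith+
  then have "2 * l \<le> x" "x \<le> 8 * l"
    unfolding 2 8 using x by (simp_all add: le_log_iff log_le_iff)
  moreover have "even \<lfloor>log 2 t\<rfloor> = b" if t: "l \<le> t" "t < 2 * l" for t
  proof -
    have "0 < l" by (simp add: l_def)
    with t have "0 < t" by linarith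
    then have "real_of_int j \<le> log 2 t" "log 2 t < real_of_int j + 1"
      using t unfolding 2 by (simp_all add: le_log_iff log_less_iff l_def)
    then have "\<lfloor>log 2 t\<rfloor> = j" by (simp add: floor_eq_iff)
    with j show ?thesis by simp
  qed
  ultimately show thesis by (intro that[of l]) (auto simp: l_def)
qed

text \<open>A whole block of the opposite parity, of length \<open>l \<ge> x / 8\<close>, is missing
  from the set. The proportion \<open>7/8\<close> is crude; what counts is that it is below
  \<open>1\<close> and independent of \<open>x\<close>.\<close>

lemma emeasure_dyadic_le:
  assumes x: "0 < x"
  shows "emeasure lebesgue ({t. even \<lfloor>log 2 t\<rfloor> = b} \<inter> {0<..<x}) \<le> ennreal (7 / 8 * x)"
proof -
  obtain l where l: "0 < l" "2 * l \<le> x" "x \<le> 8 * l"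
    "\<And>t. l \<le> t \<Longrightarrow> t < 2 * l \<Longrightarrow> even \<lfloor>log 2 t\<rfloor> = (\<not> b)"
    using dyadic_gap[OF x, of "\<not> b"] by metis
  have "{t. even \<lfloor>log 2 t\<rfloor> = b} \<inter> {0<..<x} \<subseteq> {0<..<l} \<union> {2 * l..<x}"
  proof
    fix t assume "t \<in> {t. even \<lfloor>log 2 t\<rfloor> = b} \<inter> {0<..<x}"
    then show "t \<in> {0<..<l} \<union> {2 * l..<x}" using l(4)[of t] by (cases "l \<le> t \<and> t < 2 * l") auto
  qed
  then have "emeasure lebesgue ({t. even \<lfloor>log 2 t\<rfloor> = b} \<inter> {0<..<x})
      \<le> emeasure lebesgue ({0<..<l} \<union> {2 * l..<x})"
    by (rule emeasure_mono) auto
  also have "\<dots> \<le> emeasure lebesgue {0<..<l} + emeasure lebesgue {2 * l..<x}"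
    by (rule emeasure_subadditive) auto
  also have "\<dots> = ennreal (x - l)" using l by (simp flip: ennreal_plus)
  also have "\<dots> \<le> ennreal (7 / 8 * x)" using l by (intro ennreal_leI) auto
  finally show ?thesis .
qed

section \<open>The modular on decreasing functions\<close>

locale orlicz_lorentz = initial_interval +
  fixes \<phi> w :: "real \<Rightarrow> real"
  assumes \<phi>: "orlicz_function \<phi>" and w: "decreasing_weight I w"
begin

text \<open>The modular detached from any underlying \<open>f\<close>, so that suprema, sums and
  dilates of rearrangements can be measured without first being realized as rearrangements.\<close>

definition ext_modular :: "(real \<Rightarrow> ennreal) \<Rightarrow> ennreal" where
  "ext_modular u = (\<integral>\<^sup>+ t. modular_integrand \<phi> (u t) (w t) \<partial>lebesgue_on I)"

definition admissible :: "(real \<Rightarrow> ennreal) \<Rightarrow> bool" where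
  "admissible u \<longleftrightarrow> (\<exists>c>0. ext_modular (\<lambda>t. ennreal c * u t) < \<infinity>)"

text \<open>Every right-continuous decreasing admissible function is the rearrangement of an element of the
  class, so all assertions can be tested on such functions.\<close>

definition dilation_stable :: "real \<Rightarrow> bool" where
  "dilation_stable k \<longleftrightarrow>
     (\<forall>u. decreasing_rc I u \<longrightarrow> admissible u \<longrightarrow> admissible (\<lambda>t. u (t / k)))"

text \<open>The Luxemburg functional: the Minkowski functional of the unit ball of the
  modular.\<close>

definition ext_norm :: "(real \<Rightarrow> ennreal) \<Rightarrow> ennreal" where
  "ext_norm u = Inf (ennreal ` {\<epsilon>. 0 < \<epsilon> \<and> ext_modular (\<lambda>t. ennreal (1 / \<epsilon>) * u t) \<le> 1})"

lemma w_nonneg: "t \<in> I \<Longrightarrow> 0 \<le> w t"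
  using w by (simp add: decreasing_weight_def)

lemma measurable_integrand:
  "u \<in> borel_measurable (lebesgue_on I) \<Longrightarrow>
    (\<lambda>t. modular_integrand \<phi> (u t) (w t)) \<in> borel_measurable (lebesgue_on I)"
  using w by (intro measurable_modular_integrand[OF \<phi>]) (auto simp: decreasing_weight_def L0_def)

lemma ext_modular_mono:
  assumes "\<And>t. t \<in> I \<Longrightarrow> u t \<le> v t"
  shows "ext_modular u \<le> ext_modular v"
  unfolding ext_modular_def
  using assms by (intro nn_integral_mono modular_integrand_mono[OF \<phi>] w_nonneg) auto

lemma ext_modular_zero: "ext_modular (\<lambda>_. 0) = 0"
  by (simp add: ext_modular_def modular_integrand_zero[OF \<phi>])

lemma ext_modular_convex:
  assumes [measurable]: "u \<in> borel_measurable (lebesgue_on I)" "v \<in> borel_measurable (lebesgue_on I)"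
    and pq: "0 < p" "0 < q" "p + q = 1"
  shows "ext_modular (\<lambda>t. ennreal p * u t + ennreal q * v t)
    \<le> ennreal p * ext_modular u + ennreal q * ext_modular v"
proof -
  have [measurable]: "(\<lambda>t. modular_integrand \<phi> (u t) (w t)) \<in> borel_measurable (lebesgue_on I)"
    "(\<lambda>t. modular_integrand \<phi> (v t) (w t)) \<in> borel_measurable (lebesgue_on I)"
    by (rule measurable_integrand, fact)+
  have "ext_modular (\<lambda>t. ennreal p * u t + ennreal q * v t)
    \<le> (\<integral>\<^sup>+ t. ennreal p * modular_integrand \<phi> (u t) (w t)
          + ennreal q * modular_integrand \<phi> (v t) (w t) \<partial>lebesgue_on I)"
    unfolding ext_modular_def
    using pq by (intro nn_integral_mono modular_integrand_convex[OF \<phi>] w_nonneg) auto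
  also have "\<dots> = ennreal p * ext_modular u + ennreal q * ext_modular v"
    unfolding ext_modular_def by (simp add: nn_integral_add nn_integral_cmult)
  finally show ?thesis .
qed

text \<open>Convexity against the zero function, whose modular vanishes; \<open>p = 1\<close> is
  separate because the second weight must be positive.\<close>

lemma ext_modular_shrink:
  assumes "u \<in> borel_measurable (lebesgue_on I)" "0 < p" "p \<le> 1"
  shows "ext_modular (\<lambda>t. ennreal p * u t) \<le> ennreal p * ext_modular u"
proof (cases "p = 1")
  case False
  then show ?thesis
    using ext_modular_convex[of u "\<lambda>_. 0" p "1 - p"] assms by (simp add: ext_modular_zero)
qed simp

text \<open>A supremum of non-negative numbers is at most their sum. A sum of functions would admit
  no such bound, since a convex \<open>\<phi>\<close> with \<open>\<phi> 0 = 0\<close> is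
  superadditive.\<close>

lemma ext_modular_half_SUP:
  fixes u :: "nat \<Rightarrow> real \<Rightarrow> ennreal"
  assumes "\<And>n. u n \<in> borel_measurable (lebesgue_on I)"
  shows "ext_modular (\<lambda>t. ennreal (1/2) * (SUP n. u n t)) \<le> (\<Sum>n. ext_modular (u n))"
proof -
  have SUP_le: "(SUP n. x n) \<le> (\<Sum>n. x n)" for x :: "nat \<Rightarrow> ennreal"
    using sum_le_suminf[OF summableI, of "{n}" x for n] by (intro SUP_least) auto
  have "ext_modular (\<lambda>t. ennreal (1/2) * (SUP n. u n t))
      \<le> (\<integral>\<^sup>+ t. (\<Sum>n. modular_integrand \<phi> (u n t) (w t)) \<partial>lebesgue_on I)"
    unfolding ext_modular_def
    by (intro nn_integral_mono order_trans[OF modular_integrand_half_SUP[OF \<phi>] SUP_le] w_nonneg) auto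
  also have "\<dots> = (\<Sum>n. ext_modular (u n))"
    unfolding ext_modular_def by (intro nn_integral_suminf measurable_integrand assms)
  finally show ?thesis .
qed

text \<open>The integral gives finiteness only almost everywhere; monotonicity carries it from a
  point on the left to \<open>t\<close>.\<close>

lemma ext_modular_finite:
  assumes u: "decreasing_rc I u" and fin: "ext_modular u < \<infinity>" and t: "t \<in> I"
  shows "u t < \<infinity>"
proof -
  have "AE t in lebesgue_on I. modular_integrand \<phi> (u t) (w t) \<noteq> \<infinity>"
    using fin unfolding ext_modular_def
    by (intro nn_integral_PInf_AE measurable_integrand decreasing_rc_measurable[OF u]) auto
  then have "AE t in lebesgue_on I. u t < \<infinity>"
    by (rule AE_mp, intro AE_I2 impI) (auto simp: less_top[symmetric])
  from AE_I_less[OF this t] obtain r where r: "r \<in> I" "r < t" "u r < \<infinity>" .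
  then show ?thesis
    using decreasing_rc_antimono[OF u t r(1)] by auto
qed

section \<open>Admissible functions\<close>

lemma admissible_finite:
  assumes "decreasing_rc I u" "admissible u" "t \<in> I"
  shows "u t < \<infinity>"
proof -
  obtain c where c: "0 < c" "ext_modular (\<lambda>t. ennreal c * u t) < \<infinity>"
    using assms(2) by (auto simp: admissible_def)
  from ext_modular_finite[OF decreasing_rc_scale[OF assms(1) c(1)] c(2) assms(3)] c(1)
  show ?thesis by (auto simp: ennreal_mult_less_top)
qed

lemma admissible_mono:
  assumes "admissible v" "\<And>t. t \<in> I \<Longrightarrow> u t \<le> v t"
  shows "admissible u"
proof -
  obtain c where c: "0 < c" "ext_modular (\<lambda>t. ennreal c * v t) < \<infinity>"
    using assms(1) by (auto simp: admissible_def)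
  have "ext_modular (\<lambda>t. ennreal c * u t) \<le> ext_modular (\<lambda>t. ennreal c * v t)"
    using assms(2) by (intro ext_modular_mono mult_left_mono) auto
  with c show ?thesis unfolding admissible_def by (meson le_less_trans)
qed

lemma admissible_small:
  assumes u: "decreasing_rc I u" and "admissible u"
  obtains d where "0 < d" "ext_modular (\<lambda>t. ennreal d * u t) \<le> 1"
proof -
  obtain c where c: "0 < c" "ext_modular (\<lambda>t. ennreal c * u t) < \<infinity>"
    using assms(2) by (auto simp: admissible_def)
  then obtain K where K: "0 \<le> K" "ext_modular (\<lambda>t. ennreal c * u t) = ennreal K"
    by (cases "ext_modular (\<lambda>t. ennreal c * u t)") auto
  \<comment> \<open>Adding \<open>1\<close> to \<open>K\<close> avoids a division by zero and keeps
    \<open>p\<close> at most \<open>1\<close>, as convexity requires.\<close>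
  define p where "p = 1 / (K + 1)"
  have p: "0 < p" "p \<le> 1" "p * K \<le> 1" using K by (auto simp: p_def field_simps)
  have "ext_modular (\<lambda>t. ennreal p * (ennreal c * u t)) \<le> ennreal p * ennreal K"
    unfolding K(2)[symmetric]
    by (intro ext_modular_shrink p decreasing_rc_measurable decreasing_rc_scale u c)
  also have "\<dots> \<le> 1" using p K by (simp flip: ennreal_mult ennreal_1)
  finally show thesis
    using that[of "p * c"] p c by (simp add: ennreal_scale_scale)
qed

lemma admissible_add:
  assumes u: "decreasing_rc I u" "admissible u" and v: "decreasing_rc I v" "admissible v"
  shows "admissible (\<lambda>t. u t + v t)"
proof -
  obtain c d where c: "0 < c" "ext_modular (\<lambda>t. ennreal c * u t) \<le> 1"
    and d: "0 < d" "ext_modular (\<lambda>t. ennreal d * v t) \<le> 1"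
    using admissible_small u v by metis
  \<comment> \<open>With this \<open>e\<close>, the function \<open>e * (u + v)\<close> lies below
    the midpoint of \<open>c * u\<close> and \<open>d * v\<close>, where convexity applies.\<close>
  define e where "e = min c d / 2"
  have e: "0 < e" "e \<le> 1/2 * c" "e \<le> 1/2 * d" using c d by (auto simp: e_def)
  have "ext_modular (\<lambda>t. ennreal e * (u t + v t))
      \<le> ext_modular (\<lambda>t. ennreal (1/2) * (ennreal c * u t) + ennreal (1/2) * (ennreal d * v t))"
  proof (rule ext_modular_mono)
    fix t
    have "ennreal e * u t \<le> ennreal (1/2 * c) * u t" "ennreal e * v t \<le> ennreal (1/2 * d) * v t"
      using e by (auto intro!: mult_right_mono ennreal_leI)
    then show "ennreal e * (u t + v t)
        \<le> ennreal (1/2) * (ennreal c * u t) + ennreal (1/2) * (ennreal d * v t)"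
      using c(1) d(1) by (subst (1 2) ennreal_scale_scale) (auto simp: distrib_left intro!: add_mono)
  qed
  also have "\<dots> \<le> ennreal (1/2) * ext_modular (\<lambda>t. ennreal c * u t)
      + ennreal (1/2) * ext_modular (\<lambda>t. ennreal d * v t)"
    by (intro ext_modular_convex decreasing_rc_measurable decreasing_rc_scale u v c d) auto
  also have "\<dots> < \<infinity>"
    using le_less_trans[OF c(2) ennreal_one_less_top] le_less_trans[OF d(2) ennreal_one_less_top]
    by (simp add: ennreal_mult_less_top del: ennreal_half)
  finally show ?thesis using e(1) by (auto simp: admissible_def)
qed

section \<open>Passage between the class and decreasing functions\<close>

lemma modular_eq: "modular \<phi> w I f = ext_modular (rearrangement I f)"
  by (simp add: modular_def ext_modular_def)

lemma modular_scale:
  "c \<noteq> 0 \<Longrightarrow> modular \<phi> w I (\<lambda>t. c * f t) = ext_modular (\<lambda>t. ennreal \<bar>c\<bar> * rearrangement I f t)"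
  by (simp add: modular_eq rearrangement_scale ext_modular_def)

lemma M_class_iff: "f \<in> M_class \<phi> w I \<longleftrightarrow> f \<in> L0 I \<and> admissible (rearrangement I f)"
  unfolding M_class_def admissible_def by (auto simp: modular_scale)

lemma M_norm_eq: "M_norm \<phi> w I f = ext_norm (rearrangement I f)"
proof -
  have "modular \<phi> w I (\<lambda>t. f t / \<epsilon>) = ext_modular (\<lambda>t. ennreal (1 / \<epsilon>) * rearrangement I f t)"
    if "0 < \<epsilon>" for \<epsilon>
    using that modular_scale[of "1 / \<epsilon>" f] by simp
  then show ?thesis
    unfolding M_norm_def ext_norm_def by (intro arg_cong[where f = Inf] image_cong) auto
qed

lemma M_class_rc: "f \<in> M_class \<phi> w I \<Longrightarrow> decreasing_rc I (rearrangement I f)"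
  by (simp add: M_class_iff rearrangement_decreasing_rc)

lemma enn2real_rearrangement:
  "decreasing_rc I u \<Longrightarrow> admissible u \<Longrightarrow> t \<in> I \<Longrightarrow> rearrangement I (\<lambda>t. enn2real (u t)) t = u t"
  by (intro rearrangement_enn2real admissible_finite)

lemma enn2real_M_class:
  assumes u: "decreasing_rc I u" "admissible u"
  shows "(\<lambda>t. enn2real (u t)) \<in> M_class \<phi> w I"
  unfolding M_class_iff
proof
  show "admissible (rearrangement I (\<lambda>t. enn2real (u t)))"
    by (rule admissible_mono[OF u(2)]) (simp add: enn2real_rearrangement[OF u])
qed (rule enn2real_L0[OF u(1)])

lemma D2_M_class:
  assumes "dilation_stable 2" "f \<in> M_class \<phi> w I"
  shows "D2 f \<in> M_class \<phi> w I"
  unfolding M_class_iff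
proof
  have f: "f \<in> L0 I" "admissible (rearrangement I f)" using assms by (auto simp: M_class_iff)
  show "D2 f \<in> L0 I"
    by (rule D2_measurable[OF f(1) I_sets(1)]) (use I_divide[of _ 2] in simp)
  have "admissible (\<lambda>t. rearrangement I f (t / 2))"
    using assms M_class_rc f by (auto simp: dilation_stable_def)
  then show "admissible (rearrangement I (D2 f))"
    by (rule admissible_mono) (rule rearrangement_D2_le[OF f(1)])
qed

text \<open>\<open>D2\<close> is tested on \<open>u\<close> itself. The dilate is again decreasing
  and right-continuous, hence its own rearrangement, so nothing is lost to the part of a level set
  that leaves \<open>I\<close>.\<close>

lemma dilation_stable_if_acts:
  assumes "acts_on D2 (M_class \<phi> w I)"
  shows "dilation_stable 2"
  unfolding dilation_stable_def
proof (intro allI impI)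
  fix u assume u: "decreasing_rc I u" "admissible u"
  have D2: "D2 (\<lambda>t. enn2real (u t)) = (\<lambda>t. enn2real (u (t / 2)))" by (simp add: D2_def)
  have "admissible (rearrangement I (\<lambda>t. enn2real (u (t / 2))))"
    using assms enn2real_M_class[OF u] unfolding D2[symmetric] by (simp add: acts_on_def M_class_iff)
  moreover have "rearrangement I (\<lambda>t. enn2real (u (t / 2))) t = u (t / 2)" if "t \<in> I" for t
    using that u
    by (intro rearrangement_enn2real decreasing_rc_dilate admissible_finite[OF u] I_divide) auto
  ultimately show "admissible (\<lambda>t. u (t / 2))"
    by (auto elim: admissible_mono)
qed

lemma acts_iff: "acts_on D2 (M_class \<phi> w I) \<longleftrightarrow> dilation_stable 2"
  using D2_M_class dilation_stable_if_acts by (auto simp: acts_on_def)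

lemma linear_if_stable:
  assumes stable: "dilation_stable 2"
  shows "linear_class (M_class \<phi> w I)"
proof -
  have zero: "(\<lambda>_. 0) \<in> M_class \<phi> w I"
  proof -
    have "ext_modular (\<lambda>t. ennreal 1 * rearrangement I (\<lambda>_. 0) t) \<le> ext_modular (\<lambda>_. 0)"
      by (rule ext_modular_mono) (simp add: rearrangement_zero)
    then show ?thesis
      unfolding M_class_iff admissible_def
      by (auto simp: L0_def ext_modular_zero intro!: exI[of _ 1])
  qed
  have add: "(\<lambda>t. f t + g t) \<in> M_class \<phi> w I" if "f \<in> M_class \<phi> w I" "g \<in> M_class \<phi> w I" for f g
  proof -
    have f: "f \<in> L0 I" "admissible (rearrangement I f)"
      and g: "g \<in> L0 I" "admissible (rearrangement I g)" using that by (auto simp: M_class_iff)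
    have "admissible (\<lambda>t. rearrangement I f (t / 2) + rearrangement I g (t / 2))"
      using stable f g rearrangement_decreasing_rc
      by (intro admissible_add decreasing_rc_dilate) (auto simp: dilation_stable_def)
    then have "admissible (rearrangement I (\<lambda>t. f t + g t))"
      by (rule admissible_mono) (rule rearrangement_add[OF f(1) g(1)])
    with f g show ?thesis by (auto simp: M_class_iff L0_def)
  qed
  have scale: "(\<lambda>t. c * f t) \<in> M_class \<phi> w I" if f: "f \<in> M_class \<phi> w I" for c f
  proof (cases "c = 0")
    case False
    obtain d where d: "0 < d" "ext_modular (\<lambda>t. ennreal d * rearrangement I f t) < \<infinity>"
      using f by (auto simp: M_class_iff admissible_def)
    have "ext_modular (\<lambda>t. ennreal (d / \<bar>c\<bar>) * rearrangement I (\<lambda>t. c * f t) t)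
        = ext_modular (\<lambda>t. ennreal d * rearrangement I f t)"
      using False d by (simp add: rearrangement_scale ennreal_scale_scale)
    then have "admissible (rearrangement I (\<lambda>t. c * f t))"
      unfolding admissible_def using d False by (intro exI[of _ "d / \<bar>c\<bar>"]) auto
    then show ?thesis using f by (auto simp: M_class_iff L0_def)
  qed (use zero in simp)
  from zero add scale show ?thesis by (auto simp: linear_class_def)
qed

section \<open>From linearity to the dilation by two\<close>

lemma dilation_stable_power:
  assumes "dilation_stable k" "1 \<le> k"
  shows "dilation_stable (k ^ n)"
proof (induction n)
  case (Suc n)
  show ?case unfolding dilation_stable_def
  proof (intro allI impI)
    fix u assume "decreasing_rc I u" "admissible u"
    then have "decreasing_rc I (\<lambda>t. u (t / k))" "admissible (\<lambda>t. u (t / k))"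
      using assms by (auto simp: dilation_stable_def decreasing_rc_dilate)
    with Suc have "admissible (\<lambda>t. u (t / k ^ n / k))"
      by (auto simp: dilation_stable_def)
    then show "admissible (\<lambda>t. u (t / k ^ Suc n))" by (simp add: mult.commute)
  qed
qed (simp add: dilation_stable_def)

text \<open>A larger factor moves the argument to the left, where \<open>u\<close> is
  larger.\<close>

lemma dilation_stable_mono:
  assumes "dilation_stable k'" "1 \<le> k" "k \<le> k'"
  shows "dilation_stable k"
  unfolding dilation_stable_def
proof (intro allI impI)
  fix u assume u: "decreasing_rc I u" "admissible u"
  then have "admissible (\<lambda>t. u (t / k'))" using assms by (auto simp: dilation_stable_def)
  then show "admissible (\<lambda>t. u (t / k))"
  proof (rule admissible_mono)
    fix t assume t: "t \<in> I"
    then have "t / k' \<le> t / k" using I_pos[OF t] assms by (intro divide_left_mono) auto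
    then show "u (t / k) \<le> u (t / k')"
      using t assms by (intro decreasing_rc_antimono[OF u(1)] I_divide) auto
  qed
qed

text \<open>The dilate of \<open>u\<close> is cut into two pieces living on alternating dyadic scales. Each set of scales
  fills at most \<open>7/8\<close> of every \<open>(0, x)\<close>, so the rearrangement of either piece is at most \<open>u\<close>.\<close>

lemma linear_imp_stable_8_7:
  assumes linear: "linear_class (M_class \<phi> w I)"
  shows "dilation_stable (8 / 7)"
  unfolding dilation_stable_def
proof (intro allI impI)
  fix u assume u: "decreasing_rc I u" "admissible u"
  define v where "v = (\<lambda>t. u (t / (8 / 7)))"
  have v: "decreasing_rc I v" unfolding v_def by (rule decreasing_rc_dilate[OF u(1)]) simp
  have I_87: "t / (8 / 7) \<in> I" if "t \<in> I" for t using I_divide[OF that, of "8/7"] by simp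
  have v_fin: "v t < \<infinity>" if "t \<in> I" for t
    unfolding v_def by (rule admissible_finite[OF u I_87[OF that]])
  define h where "h b t = (if even \<lfloor>log 2 t\<rfloor> = b then enn2real (v t) else 0)" for b t
  have "h b \<in> M_class \<phi> w I" for b
    unfolding M_class_iff
  proof
    have [measurable]: "(\<lambda>t. enn2real (v t)) \<in> borel_measurable (lebesgue_on I)"
      using enn2real_L0[OF v] by (simp add: L0_def)
    have "(\<lambda>t. even \<lfloor>log 2 t\<rfloor> = b) \<in> measurable borel (count_space UNIV)" by measurable
    then have [measurable]: "(\<lambda>t. even \<lfloor>log 2 t\<rfloor> = b) \<in> measurable (lebesgue_on I) (count_space UNIV)"
      by (intro measurable_restrict_space1 measurable_completion) simp
    show hL: "h b \<in> L0 I" unfolding L0_def h_def by measurable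
    have "rearrangement I (h b) t \<le> u t" if t: "t \<in> I" for t
    proof -
      have ut: "u t < \<infinity>" by (rule admissible_finite[OF u t])
      have "{r \<in> I. enn2real (u t) < \<bar>h b r\<bar>} \<subseteq> {r. even \<lfloor>log 2 r\<rfloor> = b} \<inter> {0<..<8 / 7 * t}"
      proof
        fix r assume "r \<in> {r \<in> I. enn2real (u t) < \<bar>h b r\<bar>}"
        \<comment> \<open>Off the chosen scales \<open>h b\<close> is \<open>0\<close>, which cannot
          exceed a non-negative level, so \<open>r\<close> lies on them.\<close>
        then have r: "r \<in> I" "even \<lfloor>log 2 r\<rfloor> = b" "enn2real (u t) < enn2real (v r)"
          by (auto simp: h_def not_less split: if_splits) (use enn2real_nonneg[of "u t"] in linarith)+
        have "\<not> t \<le> r / (8 / 7)"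
        proof
          assume "t \<le> r / (8 / 7)"
          then have "v r \<le> u t" unfolding v_def
            by (rule decreasing_rc_antimono[OF u(1) I_87[OF r(1)] t])
          then have "enn2real (v r) \<le> enn2real (u t)" using ut by (intro enn2real_mono) auto
          with r show False by simp
        qed
        then show "r \<in> {r. even \<lfloor>log 2 r\<rfloor> = b} \<inter> {0<..<8 / 7 * t}"
          using r I_pos[OF r(1)] by auto
      qed
      then have "distribution_fun I (h b) (enn2real (u t))
          \<le> emeasure lebesgue ({r. even \<lfloor>log 2 r\<rfloor> = b} \<inter> {0<..<8 / 7 * t})"
        unfolding distribution_fun_def
      proof (rule emeasure_mono)
        have "{r \<in> space borel. even \<lfloor>log 2 r\<rfloor> = b} \<in> sets borel" by measurable
        then show "{r. even \<lfloor>log 2 r\<rfloor> = b} \<inter> {0<..<8 / 7 * t} \<in> sets lebesgue" by auto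
      qed
      \<comment> \<open>The dilation factor is the reciprocal of the proportion filled by the
        scales, so the bound is exactly \<open>t\<close>.\<close>
      also have "\<dots> \<le> ennreal (7 / 8 * (8 / 7 * t))"
        using I_pos[OF t] by (intro emeasure_dyadic_le) simp
      finally have "rearrangement I (h b) t \<le> ennreal (enn2real (u t))"
        by (intro rearrangement_le) auto
      then show ?thesis using ut by simp
    qed
    with u(2) show "admissible (rearrangement I (h b))" by (rule admissible_mono)
  qed
  then have "(\<lambda>t. h True t + h False t) \<in> M_class \<phi> w I"
    using linear by (simp add: linear_class_def)
  moreover have "(\<lambda>t. h True t + h False t) = (\<lambda>t. enn2real (v t))"
    by (auto simp: h_def)
  ultimately have "admissible (rearrangement I (\<lambda>t. enn2real (v t)))"
    by (simp add: M_class_iff)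
  then show "admissible (\<lambda>t. u (t / (8 / 7)))"
    unfolding v_def[symmetric]
    by (rule admissible_mono) (simp add: rearrangement_enn2real[OF v v_fin])
qed

lemma stable_if_linear:
  assumes "linear_class (M_class \<phi> w I)"
  shows "dilation_stable 2"
  \<comment> \<open>\<open>6\<close> is the least exponent for which the power of \<open>8/7\<close>
    reaches \<open>2\<close>.\<close>
  using dilation_stable_power[OF linear_imp_stable_8_7[OF assms], of 6]
  by (rule dilation_stable_mono) (simp_all add: power_divide)

text \<open>A gliding hump: a sequence violating boundedness with constants \<open>4 ^ n\<close> is amalgamated into the
  single function \<open>v\<close>, whose dilate would not be admissible.\<close>

lemma stable_imp_bounded:
  assumes stable: "dilation_stable 2"
  obtains C where "1 \<le> C"
    "\<And>u. decreasing_rc I u \<Longrightarrow> ext_modular u \<le> 1 \<Longrightarrow> ext_modular (\<lambda>t. ennreal (1 / C) * u (t / 2)) \<le> 1"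
proof (rule ccontr)
  assume "\<not> thesis"
  then have "\<exists>u. decreasing_rc I u \<and> ext_modular u \<le> 1 \<and> \<not> ext_modular (\<lambda>t. ennreal (1 / 4 ^ n) * u (t / 2)) \<le> 1"
    for n :: nat using that[of "4 ^ n"] by auto
  then obtain U where U: "\<And>n. decreasing_rc I (U n)" "\<And>n. ext_modular (U n) \<le> 1"
    "\<And>n::nat. \<not> ext_modular (\<lambda>t. ennreal (1 / 4 ^ n) * U n (t / 2)) \<le> 1" by metis
  \<comment> \<open>Of each \<open>4 ^ n\<close>, one factor \<open>2 ^ n\<close> is spent here to
    make the modulars summable; the other remains to outgrow \<open>1 / d\<close> at the
    end.\<close>
  define g where "g n t = ennreal ((1/2) ^ n) * U n t" for n t
  define v where "v t = ennreal (1/2) * (SUP n. g n t)" for t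
  have g: "decreasing_rc I (g n)" for n
    unfolding g_def by (intro decreasing_rc_scale U) simp
  have v: "decreasing_rc I v"
    unfolding v_def by (intro decreasing_rc_scale decreasing_rc_SUP g) simp
  have "ext_modular (g n) \<le> ennreal ((1/2) ^ n)" for n
  proof -
    have "ext_modular (g n) \<le> ennreal ((1/2) ^ n) * ext_modular (U n)"
      unfolding g_def by (intro ext_modular_shrink decreasing_rc_measurable U) (auto simp: power_le_one)
    also have "\<dots> \<le> ennreal ((1/2) ^ n) * 1" by (intro mult_left_mono U) auto
    finally show ?thesis by simp
  qed
  then have "(\<Sum>n. ext_modular (g n)) \<le> (\<Sum>n. ennreal ((1/2) ^ n))"
    by (intro suminf_le) auto
  also have "\<dots> = ennreal (\<Sum>n. (1/2) ^ n)"
    by (rule suminf_ennreal2) auto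
  also have "\<dots> < \<infinity>" by simp
  finally have "(\<Sum>n. ext_modular (g n)) < \<infinity>" .
  with ext_modular_half_SUP[of g, OF decreasing_rc_measurable[OF g]]
  have "ext_modular v < \<infinity>"
    unfolding v_def by (rule le_less_trans)
  then have "admissible v" unfolding admissible_def by (intro exI[of _ 1]) simp
  then have "admissible (\<lambda>t. v (t / 2))" using stable v by (simp add: dilation_stable_def)
  moreover have "decreasing_rc I (\<lambda>t. v (t / 2))" by (rule decreasing_rc_dilate[OF v]) simp
  ultimately obtain d where d: "0 < d" "ext_modular (\<lambda>t. ennreal d * v (t / 2)) \<le> 1"
    using admissible_small by blast
  \<comment> \<open>The bound is \<open>d / 2\<close> rather than \<open>d\<close> to make up for
    the factor \<open>1/2\<close> in \<open>v\<close>.\<close>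
  obtain n where n: "(1/2) ^ n < d / 2"
    using real_arch_pow_inv[of "d / 2" "1 / 2"] d by auto
  have "ext_modular (\<lambda>t. ennreal (1 / 4 ^ n) * U n (t / 2)) \<le> ext_modular (\<lambda>t. ennreal d * v (t / 2))"
  proof (rule ext_modular_mono)
    fix t
    have "(1 / 4 ^ n :: real) = (1/2) ^ n * (1/2) ^ n"
      by (simp flip: power_mult_distrib add: power_divide)
    then have "ennreal (1 / 4 ^ n) * U n (t / 2) = ennreal ((1/2) ^ n) * g n (t / 2)"
      by (simp only: g_def) (subst ennreal_scale_scale, auto)
    also have "\<dots> \<le> ennreal (d / 2) * (SUP n. g n (t / 2))"
      using n by (intro mult_mono ennreal_leI SUP_upper) auto
    also have "\<dots> = ennreal d * v (t / 2)"
      unfolding v_def using d by (subst ennreal_scale_scale) auto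
    finally show "ennreal (1 / 4 ^ n) * U n (t / 2) \<le> ennreal d * v (t / 2)" .
  qed
  with d U(3)[of n] show False by auto
qed

section \<open>The Luxemburg functional on decreasing functions\<close>

lemma ext_norm_mono:
  assumes "\<And>t. t \<in> I \<Longrightarrow> u t \<le> v t"
  shows "ext_norm u \<le> ext_norm v"
proof -
  have "ext_modular (\<lambda>t. ennreal (1 / \<epsilon>) * u t) \<le> ext_modular (\<lambda>t. ennreal (1 / \<epsilon>) * v t)" for \<epsilon>
    using assms by (intro ext_modular_mono mult_left_mono) auto
  then show ?thesis
    unfolding ext_norm_def by (intro Inf_superset_mono image_mono) (auto intro: order_trans)
qed

lemma ext_norm_le:
  "0 < \<epsilon> \<Longrightarrow> ext_modular (\<lambda>t. ennreal (1 / \<epsilon>) * u t) \<le> 1 \<Longrightarrow> ext_norm u \<le> ennreal \<epsilon>"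
  unfolding ext_norm_def by (intro Inf_lower) auto

lemma ext_norm_finite:
  assumes "decreasing_rc I u" "admissible u"
  shows "ext_norm u < \<infinity>"
proof -
  obtain d where "0 < d" "ext_modular (\<lambda>t. ennreal d * u t) \<le> 1"
    using admissible_small[OF assms] .
  then have "ext_norm u \<le> ennreal (1 / d)" by (intro ext_norm_le) auto
  then show ?thesis by (auto intro: le_less_trans)
qed

lemma ext_norm_scale_le:
  assumes c: "0 < c"
  shows "ext_norm (\<lambda>t. ennreal c * u t) \<le> ennreal c * ext_norm u"
  unfolding ext_norm_def[of u]
proof (rule le_mult_Inf_ennreal[OF c], safe)
  fix \<epsilon> :: real assume "0 < \<epsilon>" "ext_modular (\<lambda>t. ennreal (1 / \<epsilon>) * u t) \<le> 1"
  then have "ext_norm (\<lambda>t. ennreal c * u t) \<le> ennreal (c * \<epsilon>)"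
    using c by (intro ext_norm_le) (simp_all add: ennreal_scale_scale)
  then show "ext_norm (\<lambda>t. ennreal c * u t) \<le> ennreal c * ennreal \<epsilon>"
    using c \<open>0 < \<epsilon>\<close> by (simp add: ennreal_mult)
qed

lemma ext_norm_scale:
  assumes c: "0 < c"
  shows "ext_norm (\<lambda>t. ennreal c * u t) = ennreal c * ext_norm u"
proof (rule antisym[OF ext_norm_scale_le[OF c]])
  have "ext_norm u \<le> ennreal (1 / c) * ext_norm (\<lambda>t. ennreal c * u t)"
    using ext_norm_scale_le[of "1 / c" "\<lambda>t. ennreal c * u t"] c by (simp add: ennreal_scale_scale)
  then have "ennreal c * ext_norm u \<le> ennreal c * (ennreal (1 / c) * ext_norm (\<lambda>t. ennreal c * u t))"
    by (rule mult_left_mono) simp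
  then show "ennreal c * ext_norm u \<le> ext_norm (\<lambda>t. ennreal c * u t)"
    using c by (simp add: ennreal_scale_scale)
qed

text \<open>The quotient \<open>(u + v) / (x + y)\<close> is the convex combination of
  \<open>u / x\<close> and \<open>v / y\<close> with weights proportional to \<open>x\<close> and
  \<open>y\<close>. The constant is \<open>1\<close> because decreasing functions are added
  directly, without passing to a rearrangement of the sum.\<close>

lemma ext_norm_add:
  assumes u: "decreasing_rc I u" and v: "decreasing_rc I v"
  shows "ext_norm (\<lambda>t. u t + v t) \<le> ext_norm u + ext_norm v"
  unfolding ext_norm_def[of u] ext_norm_def[of v]
proof (rule le_Inf_add_Inf_ennreal, safe)
  fix x y :: real assume x: "0 < x" "ext_modular (\<lambda>t. ennreal (1 / x) * u t) \<le> 1"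
    and y: "0 < y" "ext_modular (\<lambda>t. ennreal (1 / y) * v t) \<le> 1"
  define p q where "p = x / (x + y)" and "q = y / (x + y)"
  have pq: "0 < p" "0 < q" "p + q = 1" "p * (1 / x) = 1 / (x + y)" "q * (1 / y) = 1 / (x + y)"
    using x y by (auto simp: p_def q_def simp flip: add_divide_distrib)
  have eq: "(\<lambda>t. ennreal (1 / (x + y)) * (u t + v t))
      = (\<lambda>t. ennreal p * (ennreal (1 / x) * u t) + ennreal q * (ennreal (1 / y) * v t))"
    using pq x y by (subst (1 2) ennreal_scale_scale) (auto simp: distrib_left)
  have "ext_modular (\<lambda>t. ennreal (1 / (x + y)) * (u t + v t))
      \<le> ennreal p * ext_modular (\<lambda>t. ennreal (1 / x) * u t) + ennreal q * ext_modular (\<lambda>t. ennreal (1 / y) * v t)"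
    unfolding eq using pq x y
    by (intro ext_modular_convex decreasing_rc_measurable decreasing_rc_scale u v) auto
  also have "\<dots> \<le> ennreal p * 1 + ennreal q * 1"
    using x y by (intro add_mono mult_left_mono) auto
  also have "\<dots> = 1" using pq by (simp flip: ennreal_plus)
  finally have "ext_norm (\<lambda>t. u t + v t) \<le> ennreal (x + y)"
    using x y by (intro ext_norm_le) auto
  then show "ext_norm (\<lambda>t. u t + v t) \<le> ennreal x + ennreal y"
    using x y by simp
qed

lemma ext_norm_zero_iff:
  assumes u: "decreasing_rc I u"
  shows "ext_norm u = 0 \<longleftrightarrow> (AE t in lebesgue_on I. u t = 0)"
proof
  assume zero: "ext_norm u = 0"
  have "ext_modular u \<le> ennreal e" if e: "0 < e" "e \<le> 1" for e
  proof -
    have "ext_norm u < ennreal e" using zero e by simp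
    then obtain x where x: "0 < x" "ext_modular (\<lambda>t. ennreal (1 / x) * u t) \<le> 1" "ennreal x < ennreal e"
      unfolding ext_norm_def Inf_less_iff by auto
    then have xe: "x < e" by (simp add: ennreal_less_iff)
    \<comment> \<open>Since \<open>x < 1\<close>, convexity lets the factor \<open>x\<close> leave
      the modular of a function in the unit ball; letting \<open>x\<close> tend to \<open>0\<close>
      forces the modular of \<open>u\<close> to vanish.\<close>
    have "ext_modular u = ext_modular (\<lambda>t. ennreal x * (ennreal (1 / x) * u t))"
      using x by (simp add: ennreal_scale_scale)
    also have "\<dots> \<le> ennreal x * ext_modular (\<lambda>t. ennreal (1 / x) * u t)"
      using x xe e
      by (intro ext_modular_shrink decreasing_rc_measurable decreasing_rc_scale u) auto
    also have "\<dots> \<le> ennreal x * 1" using x by (intro mult_left_mono) auto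
    also have "\<dots> \<le> ennreal e" using xe by (simp add: ennreal_leI)
    finally show ?thesis .
  qed
  then have "ext_modular u \<le> 0 + ennreal e" if "0 < e" for e
    using that order_trans[of "ext_modular u" "ennreal (min e 1)" "ennreal e"] by (auto intro: ennreal_leI)
  then have "ext_modular u = 0" using ennreal_le_epsilon[of 0 "ext_modular u"] by auto
  then have "AE t in lebesgue_on I. modular_integrand \<phi> (u t) (w t) = 0"
    unfolding ext_modular_def
    by (subst (asm) nn_integral_0_iff_AE) (auto intro: measurable_integrand decreasing_rc_measurable u)
  then show "AE t in lebesgue_on I. u t = 0"
    by (rule AE_mp, intro AE_I2 impI) (auto intro: modular_integrand_eq_0[OF \<phi>] w_nonneg)
next
  assume ae: "AE t in lebesgue_on I. u t = 0"
  have "ext_norm u \<le> 0 + ennreal e" if "0 < e" for e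
  proof -
    have "ext_modular (\<lambda>t. ennreal (1 / e) * u t) = (\<integral>\<^sup>+ t. 0 \<partial>lebesgue_on I)"
      unfolding ext_modular_def
      using ae by (intro nn_integral_cong_AE, elim AE_mp, intro AE_I2) (simp add: modular_integrand_zero[OF \<phi>])
    with that show ?thesis using ext_norm_le[of e u] by simp
  qed
  then show "ext_norm u = 0" using ennreal_le_epsilon[of 0 "ext_norm u"] by auto
qed

text \<open>Turns the bound on the unit ball of the modular into a homogeneous inequality, by
  applying it to \<open>u\<close> divided by each competitor \<open>\<epsilon>\<close>.\<close>

lemma ext_norm_dilate:
  assumes C: "0 < C" "\<And>u. decreasing_rc I u \<Longrightarrow> ext_modular u \<le> 1 \<Longrightarrow> ext_modular (\<lambda>t. ennreal (1 / C) * u (t / 2)) \<le> 1"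
    and u: "decreasing_rc I u"
  shows "ext_norm (\<lambda>t. u (t / 2)) \<le> ennreal C * ext_norm u"
  unfolding ext_norm_def[of u]
proof (rule le_mult_Inf_ennreal[OF C(1)], safe)
  fix \<epsilon> :: real assume \<epsilon>: "0 < \<epsilon>" "ext_modular (\<lambda>t. ennreal (1 / \<epsilon>) * u t) \<le> 1"
  then have "ext_modular (\<lambda>t. ennreal (1 / C) * (ennreal (1 / \<epsilon>) * u (t / 2))) \<le> 1"
    by (intro C(2) decreasing_rc_scale u) auto
  then have "ext_norm (\<lambda>t. u (t / 2)) \<le> ennreal (C * \<epsilon>)"
    using C \<epsilon> by (intro ext_norm_le) (simp_all add: ennreal_scale_scale)
  then show "ext_norm (\<lambda>t. u (t / 2)) \<le> ennreal C * ennreal \<epsilon>"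
    using C \<epsilon> by (simp add: ennreal_mult)
qed

section \<open>Bounded dilation and the quasi-norm\<close>

lemma bounded_if_stable:
  assumes "dilation_stable 2"
  shows "bounded_on D2 (M_class \<phi> w I) (M_norm \<phi> w I)"
proof -
  obtain C where C: "1 \<le> C"
    "\<And>u. decreasing_rc I u \<Longrightarrow> ext_modular u \<le> 1 \<Longrightarrow> ext_modular (\<lambda>t. ennreal (1 / C) * u (t / 2)) \<le> 1"
    using stable_imp_bounded[OF assms] by metis
  have "M_norm \<phi> w I (D2 f) \<le> ennreal C * M_norm \<phi> w I f" if "f \<in> M_class \<phi> w I" for f
  proof -
    have f: "f \<in> L0 I" using that by (simp add: M_class_iff)
    have "ext_norm (rearrangement I (D2 f)) \<le> ext_norm (\<lambda>t. rearrangement I f (t / 2))"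
      by (rule ext_norm_mono) (rule rearrangement_D2_le[OF f])
    also have "\<dots> \<le> ennreal C * ext_norm (rearrangement I f)"
      using C by (intro ext_norm_dilate rearrangement_decreasing_rc f) auto
    finally show ?thesis by (simp add: M_norm_eq)
  qed
  with C(1) show ?thesis unfolding bounded_on_def by (intro exI[of _ C]) auto
qed

lemma quasi_norm_if_stable:
  assumes "dilation_stable 2"
  shows "quasi_norm_on I (M_class \<phi> w I) (M_norm \<phi> w I)"
proof -
  obtain C where C: "1 \<le> C"
    "\<And>u. decreasing_rc I u \<Longrightarrow> ext_modular u \<le> 1 \<Longrightarrow> ext_modular (\<lambda>t. ennreal (1 / C) * u (t / 2)) \<le> 1"
    using stable_imp_bounded[OF assms] by metis
  have fin: "M_norm \<phi> w I f < \<infinity>" if "f \<in> M_class \<phi> w I" for f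
    using that by (auto simp: M_norm_eq M_class_iff intro!: ext_norm_finite[simplified] rearrangement_decreasing_rc)
  have zero: "M_norm \<phi> w I f = 0 \<longleftrightarrow> (AE t in lebesgue_on I. f t = 0)" if "f \<in> M_class \<phi> w I" for f
    using that ext_norm_zero_iff[OF M_class_rc[OF that]] rearrangement_eq_0_iff[of f]
    by (simp add: M_norm_eq M_class_iff)
  have scale: "M_norm \<phi> w I (\<lambda>t. c * f t) = ennreal \<bar>c\<bar> * M_norm \<phi> w I f" if "f \<in> M_class \<phi> w I" for c f
  proof (cases "c = 0")
    case True
    \<comment> \<open>For \<open>c = 0\<close> homogeneity says that the zero function has norm
      \<open>0\<close>, which is a case of definiteness once that function is known to belong to the
      class.\<close>
    have "(\<lambda>_. 0) \<in> M_class \<phi> w I"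
      using linear_if_stable[OF assms] by (simp add: linear_class_def)
    with True zero show ?thesis by simp
  next
    case False
    then have "rearrangement I (\<lambda>t. c * f t) = (\<lambda>t. ennreal \<bar>c\<bar> * rearrangement I f t)"
      by (simp add: fun_eq_iff rearrangement_scale)
    with False show ?thesis by (simp add: M_norm_eq ext_norm_scale)
  qed
  have add: "M_norm \<phi> w I (\<lambda>t. f t + g t) \<le> ennreal C * (M_norm \<phi> w I f + M_norm \<phi> w I g)"
    if "f \<in> M_class \<phi> w I" "g \<in> M_class \<phi> w I" for f g
  proof -
    have fg: "f \<in> L0 I" "g \<in> L0 I" using that by (auto simp: M_class_iff)
    note rc = fg[THEN rearrangement_decreasing_rc]
    have "ext_norm (rearrangement I (\<lambda>t. f t + g t))
        \<le> ext_norm (\<lambda>t. rearrangement I f (t / 2) + rearrangement I g (t / 2))"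
      by (rule ext_norm_mono) (rule rearrangement_add[OF fg])
    also have "\<dots> \<le> ext_norm (\<lambda>t. rearrangement I f (t / 2)) + ext_norm (\<lambda>t. rearrangement I g (t / 2))"
      by (intro ext_norm_add decreasing_rc_dilate rc) auto
    \<comment> \<open>Only the dilation costs a constant, so its bound \<open>C\<close> becomes the
      constant of the quasi-triangle inequality.\<close>
    also have "\<dots> \<le> ennreal C * ext_norm (rearrangement I f) + ennreal C * ext_norm (rearrangement I g)"
      using C by (intro add_mono ext_norm_dilate rc) auto
    finally show ?thesis by (simp add: M_norm_eq distrib_left)
  qed
  show ?thesis
    unfolding quasi_norm_on_def using fin zero scale add C(1) by blast
qed

end

theorem lemma3p1:
  fixes \<phi> w :: "real \<Rightarrow> real" and a :: ereal and I :: "real set"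
  assumes "orlicz_function \<phi>"
    and "0 < a"
    and "I = einterval 0 a"
    and "decreasing_weight I w"
  shows "(acts_on D2 (M_class \<phi> w I) \<longleftrightarrow>
            acts_on D2 (M_class \<phi> w I) \<and> bounded_on D2 (M_class \<phi> w I) (M_norm \<phi> w I))
       \<and> (acts_on D2 (M_class \<phi> w I) \<and> bounded_on D2 (M_class \<phi> w I) (M_norm \<phi> w I) \<longleftrightarrow>
            linear_class (M_class \<phi> w I))
       \<and> (linear_class (M_class \<phi> w I) \<longleftrightarrow>
            linear_class (M_class \<phi> w I) \<and> quasi_norm_on I (M_class \<phi> w I) (M_norm \<phi> w I))"
proof -
  interpret orlicz_lorentz a I \<phi> w
    by unfold_locales (use assms in auto)
  show ?thesis
    using acts_iff linear_if_stable stable_if_linear bounded_if_stable quasi_norm_if_stable by blast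
qed

end
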